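(* If $\ell$ and $p$ are positive integers, then the $p$th central moment $\mu^\ell_{p,(f,g)} \mathrm{CDF}(f,g)$ of the crosscorrelation demerit factor over all pairs of binary sequences of length $\ell$ (uniformly distributed) is nonnegative. Moreover, if (i) $p=1$, or (ii) $p$ is odd and $\ell \leq 2$, or (iii) $p$ is even and $\ell \leq 1$, then $\mu^\ell_{p,(f,g)} \mathrm{CDF}(f,g)$ equals $0$; otherwise it is strictly positive.
   Context: A binary sequence of length $\ell$ is a doubly infinite list $f=(f_j)_{j\in\mathbb{Z}}$ with $f_j\in\{-1,1\}$ for $0\le j\le \ell-1$ and $f_j=0$ for all other $j$. For sequences $f,g$ of complex numbers with finitely many nonzero terms and $s\in\mathbb{Z}$, the aperiodic crosscorrelation is $C_{f,g}(s)=\sum_{j\in\mathbb{Z}} f_{j+s}\overline{g_j}$. For nonzero $f,g$, the crosscorrelation demerit factor is \[ \mathrm{CDF}(f,g)=\frac{\sum_{s\in\mathbb{Z}}|C_{f,g}(s)|^2}{C_{f,f}(0)\,C_{g,g}(0)}. \] $\mathrm{Pair}(\ell)$ is the set of all $2^{2\ell}$ ordered pairs $(f,g)$ of binary sequences of length $\ell$, with uniform probability measure; $\mathbb{E}^\ell_{(f,g)} v(f,g)$ is the expected value of a random variable $v$ with respect to this measure, and its $p$th central moment is $\mu^\ell_{p,(f,g)} v(f,g)=\mathbb{E}^\ell_{(f,g)}\bigl(v(f,g)-\mathbb{E}^\ell_{(f,g)}v(f,g)\bigr)^p$. *)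

theory Defs
  imports "HOL-Probability.Probability"
begin

definition binary_seqs :: "nat \<Rightarrow> (int \<Rightarrow> complex) set" where
  "binary_seqs l =
     {f. (\<forall>j. 0 \<le> j \<and> j \<le> int l - 1 \<longrightarrow> f j \<in> {-1, 1}) \<and>
         (\<forall>j. \<not> (0 \<le> j \<and> j \<le> int l - 1) \<longrightarrow> f j = 0)}"

text \<open>All infinite sums below have only finitely many nonzero terms when \<open>f\<close> and \<open>g\<close> are
  finitely supported.\<close>

definition crosscorr :: "(int \<Rightarrow> complex) \<Rightarrow> (int \<Rightarrow> complex) \<Rightarrow> int \<Rightarrow> complex" where
  "crosscorr f g s = (\<Sum>\<^sub>\<infinity>j\<in>UNIV. f (j + s) * cnj (g j))"

text \<open>The autocorrelation of a finitely supported sequence at shift \<open>0\<close> is real, so taking real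
  parts in the denominator only moves the quotient from the complex numbers to the reals; see
  \<open>of_real_CDF\<close>.\<close>

definition CDF :: "(int \<Rightarrow> complex) \<Rightarrow> (int \<Rightarrow> complex) \<Rightarrow> real" where
  "CDF f g =
     (\<Sum>\<^sub>\<infinity>s\<in>UNIV. (cmod (crosscorr f g s))\<^sup>2) / (Re (crosscorr f f 0) * Re (crosscorr g g 0))"

definition seq_pairs :: "nat \<Rightarrow> ((int \<Rightarrow> complex) \<times> (int \<Rightarrow> complex)) set" where
  "seq_pairs l = binary_seqs l \<times> binary_seqs l"

definition expect_pair :: "nat \<Rightarrow> ((int \<Rightarrow> complex) \<Rightarrow> (int \<Rightarrow> complex) \<Rightarrow> real) \<Rightarrow> real" where
  "expect_pair l v = measure_pmf.expectation (pmf_of_set (seq_pairs l)) (\<lambda>(f, g). v f g)"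

definition central_moment_pair ::
    "nat \<Rightarrow> nat \<Rightarrow> ((int \<Rightarrow> complex) \<Rightarrow> (int \<Rightarrow> complex) \<Rightarrow> real) \<Rightarrow> real" where
  "central_moment_pair l p v = expect_pair l (\<lambda>f g. (v f g - expect_pair l v) ^ p)"

lemma crosscorr_self_0:
  assumes "finite {j. f j \<noteq> 0}"
  shows "crosscorr f f 0 = of_real (\<Sum>j | f j \<noteq> 0. (cmod (f j))\<^sup>2)"
proof -
  have "crosscorr f f 0 = (\<Sum>\<^sub>\<infinity>j\<in>{j. f j \<noteq> 0}. f j * cnj (f j))"
    unfolding crosscorr_def by (rule infsum_cong_neutral) auto
  also have "\<dots> = (\<Sum>j | f j \<noteq> 0. of_real ((cmod (f j))\<^sup>2))"
    using assms by (simp add: complex_norm_square del: of_real_power)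
  finally show ?thesis by simp
qed

lemma of_real_CDF:
  assumes "finite {j. f j \<noteq> 0}" "finite {j. g j \<noteq> 0}"
  shows "complex_of_real (CDF f g) =
    of_real (\<Sum>\<^sub>\<infinity>s\<in>UNIV. (cmod (crosscorr f g s))\<^sup>2) / (crosscorr f f 0 * crosscorr g g 0)"
  using assms by (simp add: CDF_def crosscorr_self_0)

lemma bij_betw_binary_seqs:
  "bij_betw (\<lambda>f. restrict f {0..int l - 1}) (binary_seqs l) ({0..int l - 1} \<rightarrow>\<^sub>E {-1, 1})"
  by (rule bij_betwI[where g = "\<lambda>h j. if j \<in> {0..int l - 1} then h j else 0"])
     (auto simp: binary_seqs_def PiE_iff extensional_def fun_eq_iff restrict_def)

lemma finite_binary_seqs: "finite (binary_seqs l)"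
  using bij_betw_finite[OF bij_betw_binary_seqs] by (simp add: finite_PiE)

lemma card_seq_pairs: "card (seq_pairs l) = 2 ^ (2 * l)"
proof -
  have "card {-1, 1 :: complex} = 2"
    by simp
  then have "card (binary_seqs l) = 2 ^ l"
    using bij_betw_same_card[OF bij_betw_binary_seqs[of l]] by (simp add: card_PiE numeral_2_eq_2)
  then show ?thesis
    by (simp add: seq_pairs_def card_cartesian_product mult_2 power_add)
qed

end

theory Submission
  imports Defs
begin

text \<open>Write \<open>A\<^sub>f\<close> for the autocorrelation of \<open>f\<close>. Counting quadruples of positions with equal
  differences in two ways gives \<open>\<Sum>\<^sub>s |C\<^sub>f\<^sub>g(s)|\<^sup>2 = \<Sum>\<^sub>s A\<^sub>f(s) A\<^sub>g(s)\<close>, whose term at \<open>s = 0\<close> is \<open>l\<^sup>2\<close>. So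
  \<open>CDF = 1 + X / l\<^sup>2\<close> with \<open>X = \<Sum>\<^bsub>s \<noteq> 0\<^esub> A\<^sub>f(s) A\<^sub>g(s)\<close> of mean \<open>0\<close>. As \<open>f\<close> and \<open>g\<close> are independent
  and identically distributed, \<open>E X\<^sup>p\<close> is the sum of the squares \<open>(E (A\<^sub>f(s\<^sub>1) \<cdots> A\<^sub>f(s\<^sub>p)))\<^sup>2\<close> over all
  tuples of nonzero shifts. A nonzero term is given by \<open>(l-1, \<dots>, l-1)\<close> if \<open>p\<close> is even and
  \<open>l \<ge> 2\<close>, and by \<open>(1, l-2, l-1, \<dots>, l-1)\<close> if \<open>p \<ge> 3\<close> is odd and \<open>l \<ge> 3\<close>. For \<open>l = 2\<close>,
  negating \<open>f\<^sub>0\<close> negates \<open>X\<close>, so its odd moments vanish.\<close>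

text \<open>For binary \<open>f\<close> this is \<open>crosscorr f f s\<close>, taken as a real
  number so that its powers and squares can be ordered.\<close>

definition acorr :: "nat \<Rightarrow> (int \<Rightarrow> complex) \<Rightarrow> int \<Rightarrow> real" where
  "acorr l f s = (\<Sum>j\<in>{0..<int l}. Re (f (j + s)) * Re (f j))"

text \<open>For each \<open>S\<close> this is an involution of \<open>binary_seqs l\<close>; it
  serves to show that odd functions sum to zero.\<close>

definition negate_on :: "int set \<Rightarrow> (int \<Rightarrow> complex) \<Rightarrow> int \<Rightarrow> complex" where
  "negate_on S f = (\<lambda>j. if j \<in> S then - f j else f j)"

text \<open>Autocorrelations of binary sequences vanish at all shifts of absolute value at least
  \<open>l\<close>, so the endpoints are harmless padding.\<close>

definition shifts :: "nat \<Rightarrow> int set" where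
  "shifts l = {- int l..int l} - {0}"

lemma finite_shifts [simp]: "finite (shifts l)"
  by (simp add: shifts_def)

section \<open>Demerit factor in terms of autocorrelations\<close>

lemma binary_seqs_Re:
  assumes "f \<in> binary_seqs l"
  shows "f j = of_real (Re (f j))"
    and "j \<notin> {0..<int l} \<Longrightarrow> Re (f j) = 0"
    and "j \<in> {0..<int l} \<Longrightarrow> Re (f j) * Re (f j) = 1"
proof -
  have "f j \<in> {-1, 1} \<or> f j = 0"
    using assms by (auto simp: binary_seqs_def)
  then show "f j = of_real (Re (f j))"
    by (auto simp: complex_eq_iff)
  show "j \<notin> {0..<int l} \<Longrightarrow> Re (f j) = 0"
    using assms by (auto simp: binary_seqs_def)
  assume "j \<in> {0..<int l}"
  then have "f j \<in> {-1, 1}"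
    using assms by (simp add: binary_seqs_def)
  then show "Re (f j) * Re (f j) = 1"
    by auto
qed

lemma crosscorr_binary:
  assumes "f \<in> binary_seqs l" "g \<in> binary_seqs l"
  shows "crosscorr f g s = of_real (\<Sum>j\<in>{0..<int l}. Re (f (j + s)) * Re (g j))"
proof -
  have "crosscorr f g s = (\<Sum>\<^sub>\<infinity>j\<in>{0..<int l}. f (j + s) * cnj (g j))"
    unfolding crosscorr_def using assms(2)
    by (intro infsum_cong_neutral) (auto simp: binary_seqs_def)
  also have "\<dots> = (\<Sum>j\<in>{0..<int l}. f (j + s) * cnj (g j))"
    by simp
  also have "\<dots> = (\<Sum>j\<in>{0..<int l}. of_real (Re (f (j + s)) * Re (g j)))"
    by (intro sum.cong refl, subst binary_seqs_Re(1)[OF assms(1)],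
        subst binary_seqs_Re(1)[OF assms(2)]) simp
  finally show ?thesis
    by simp
qed

lemma acorr_0:
  assumes "f \<in> binary_seqs l"
  shows "acorr l f 0 = real l"
  using binary_seqs_Re(3)[OF assms] by (simp add: acorr_def)

text \<open>The factor \<open>f (j + s)\<close> confines \<open>s\<close> to
  \<open>{-j..<int l - j}\<close>, which the bound on \<open>j\<close> keeps inside the summation
  range.\<close>

lemma acorr_shift:
  assumes f: "f \<in> binary_seqs l" and j: "j \<in> {0..<int l}"
  shows "(\<Sum>s\<in>{- int l..int l}. Re (f (j + s)) * Re (f (k + s))) = acorr l f (k - j)"
proof -
  have "(\<Sum>s\<in>{- int l..int l}. Re (f (j + s)) * Re (f (k + s)))
      = (\<Sum>s\<in>{-j..<int l - j}. Re (f (j + s)) * Re (f (k + s)))"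
    using j binary_seqs_Re(2)[OF f] by (intro sum.mono_neutral_right) auto
  also have "\<dots> = acorr l f (k - j)"
    unfolding acorr_def
    by (rule sum.reindex_bij_witness[where i = "\<lambda>i. i - j" and j = "\<lambda>s. j + s"])
       (auto simp: algebra_simps)
  finally show ?thesis .
qed

lemma sum_crosscorr_squared:
  assumes f: "f \<in> binary_seqs l" and g: "g \<in> binary_seqs l"
  shows "(\<Sum>\<^sub>\<infinity>s\<in>UNIV. (cmod (crosscorr f g s))\<^sup>2) = (\<Sum>s\<in>{- int l..int l}. acorr l f s * acorr l g s)"
proof -
  let ?I = "{0..<int l}" and ?T = "{- int l..int l}"
  let ?f = "\<lambda>j. Re (f j)" and ?g = "\<lambda>j. Re (g j)"
  have "(\<Sum>\<^sub>\<infinity>s\<in>UNIV. (cmod (crosscorr f g s))\<^sup>2) = (\<Sum>\<^sub>\<infinity>s\<in>UNIV. (\<Sum>j\<in>?I. ?f (j + s) * ?g j)\<^sup>2)"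
    by (simp only: crosscorr_binary[OF f g] norm_of_real power2_abs)
  also have "\<dots> = (\<Sum>\<^sub>\<infinity>s\<in>?T. (\<Sum>j\<in>?I. ?f (j + s) * ?g j)\<^sup>2)"
    using binary_seqs_Re(2)[OF f]
    by (intro infsum_cong_neutral) (auto intro!: sum.neutral)
  also have "\<dots> = (\<Sum>s\<in>?T. \<Sum>j\<in>?I. \<Sum>k\<in>?I. (?f (j + s) * ?g j) * (?f (k + s) * ?g k))"
    by (simp add: power2_eq_square sum_product)
  also have "\<dots> = (\<Sum>j\<in>?I. \<Sum>k\<in>?I. \<Sum>s\<in>?T. (?f (j + s) * ?g j) * (?f (k + s) * ?g k))"
    by (subst sum.swap, rule sum.cong[OF refl], rule sum.swap)
  \<comment> \<open>Summing over \<open>s\<close> first turns the two \<open>f\<close> factors into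
    an autocorrelation.\<close>
  also have "\<dots> = (\<Sum>j\<in>?I. \<Sum>k\<in>?I. ?g j * ?g k * acorr l f (k - j))"
    by (intro sum.cong refl)
       (simp add: acorr_shift[OF f, symmetric] sum_distrib_left mult_ac)
  also have "\<dots> = (\<Sum>j\<in>?I. \<Sum>s\<in>?T. ?g j * ?g (j + s) * acorr l f s)"
  proof (rule sum.cong[OF refl])
    fix j assume j: "j \<in> ?I"
    have "(\<Sum>k\<in>?I. ?g j * ?g k * acorr l f (k - j))
        = (\<Sum>s\<in>{-j..<int l - j}. ?g j * ?g (j + s) * acorr l f s)"
      by (rule sum.reindex_bij_witness[where i = "\<lambda>s. j + s" and j = "\<lambda>i. i - j"]) auto
    \<comment> \<open>At the added shifts \<open>j + s\<close> lies outside the support of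
      \<open>g\<close>.\<close>
    also have "\<dots> = (\<Sum>s\<in>?T. ?g j * ?g (j + s) * acorr l f s)"
      using j binary_seqs_Re(2)[OF g] by (intro sum.mono_neutral_left) auto
    finally show "(\<Sum>k\<in>?I. ?g j * ?g k * acorr l f (k - j))
        = (\<Sum>s\<in>?T. ?g j * ?g (j + s) * acorr l f s)" .
  qed
  also have "\<dots> = (\<Sum>s\<in>?T. \<Sum>j\<in>?I. ?g j * ?g (j + s) * acorr l f s)"
    by (rule sum.swap)
  also have "\<dots> = (\<Sum>s\<in>?T. acorr l f s * acorr l g s)"
    by (intro sum.cong refl) (simp add: acorr_def[of l g] sum_distrib_left mult_ac)
  finally show ?thesis .
qed

lemma CDF_binary:
  assumes f: "f \<in> binary_seqs l" and g: "g \<in> binary_seqs l" and "l > 0"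
  shows "CDF f g = 1 + (\<Sum>s\<in>shifts l. acorr l f s * acorr l g s) / (real l)\<^sup>2"
proof -
  have "Re (crosscorr h h 0) = real l" if "h \<in> binary_seqs l" for h
    using acorr_0[OF that] by (simp add: crosscorr_binary[OF that that] acorr_def)
  then have "CDF f g = (\<Sum>s\<in>{- int l..int l}. acorr l f s * acorr l g s) / (real l)\<^sup>2"
    using f g by (simp add: CDF_def sum_crosscorr_squared) (simp add: power2_eq_square)
  also have "(\<Sum>s\<in>{- int l..int l}. acorr l f s * acorr l g s)
      = (real l)\<^sup>2 + (\<Sum>s\<in>shifts l. acorr l f s * acorr l g s)"
    using f g unfolding shifts_def
    by (subst sum.remove[of _ 0]) (auto simp: acorr_0 power2_eq_square)
  finally show ?thesis
    using \<open>l > 0\<close> by (simp add: add_divide_distrib)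
qed

section \<open>Averages over binary sequences and sign changes\<close>

lemma binary_seqs_nonempty: "binary_seqs l \<noteq> {}"
proof -
  have "(\<lambda>j. if 0 \<le> j \<and> j \<le> int l - 1 then 1 else 0) \<in> binary_seqs l"
    by (simp add: binary_seqs_def)
  then show ?thesis
    by blast
qed

lemma expect_pair_eq_sum:
  "expect_pair l v = (\<Sum>f\<in>binary_seqs l. \<Sum>g\<in>binary_seqs l. v f g) / 2 ^ (2 * l)"
proof -
  have "expect_pair l v = (\<Sum>(f, g)\<in>seq_pairs l. v f g) / real (card (seq_pairs l))"
    unfolding expect_pair_def
    by (rule integral_pmf_of_set) (auto simp: seq_pairs_def finite_binary_seqs binary_seqs_nonempty)
  then show ?thesis
    by (simp add: card_seq_pairs) (simp add: seq_pairs_def sum.cartesian_product)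
qed

lemma negate_on_binary:
  assumes "f \<in> binary_seqs l"
  shows "negate_on S f \<in> binary_seqs l"
  using assms by (auto simp: binary_seqs_def negate_on_def)

lemma Re_negate_on: "Re (negate_on S f j) = (if j \<in> S then - Re (f j) else Re (f j))"
  by (simp add: negate_on_def)

lemma sum_negate_on:
  "(\<Sum>f\<in>binary_seqs l. F (negate_on S f)) = (\<Sum>f\<in>binary_seqs l. F f)"
  by (rule sum.reindex_bij_witness[where i = "negate_on S" and j = "negate_on S"])
     (auto simp: negate_on_binary, auto simp: negate_on_def fun_eq_iff)

text \<open>Negation on \<open>S\<close> permutes the sequences, so the sum equals its own
  negative.\<close>

lemma sum_odd_eq_0:
  fixes F :: "(int \<Rightarrow> complex) \<Rightarrow> real"
  assumes "\<And>f. f \<in> binary_seqs l \<Longrightarrow> F (negate_on S f) = - F f"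
  shows "(\<Sum>f\<in>binary_seqs l. F f) = 0"
proof -
  have "(\<Sum>f\<in>binary_seqs l. F f) = (\<Sum>f\<in>binary_seqs l. - F f)"
    using assms by (subst sum_negate_on[of F S, symmetric]) simp
  then show ?thesis
    by (simp add: sum_negf)
qed

lemma sum_acorr_eq_0:
  assumes "s \<noteq> 0"
  shows "(\<Sum>f\<in>binary_seqs l. acorr l f s) = 0"
proof -
  \<comment> \<open>As \<open>s \<noteq> 0\<close>, negating the entry at \<open>j\<close> negates
    exactly one of the two factors.\<close>
  have "(\<Sum>f\<in>binary_seqs l. Re (f (j + s)) * Re (f j)) = 0" for j
    by (rule sum_odd_eq_0[where S = "{j}"]) (use assms in \<open>simp add: Re_negate_on\<close>)
  then show ?thesis
    unfolding acorr_def by (subst sum.swap) simp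
qed

lemma sum_acorr_products_eq_0:
  "(\<Sum>f\<in>binary_seqs l. \<Sum>g\<in>binary_seqs l. \<Sum>s\<in>shifts l. acorr l f s * acorr l g s) = 0"
proof -
  have "(\<Sum>f\<in>binary_seqs l. \<Sum>g\<in>binary_seqs l. \<Sum>s\<in>shifts l. acorr l f s * acorr l g s)
      = (\<Sum>f\<in>binary_seqs l. \<Sum>s\<in>shifts l. acorr l f s * (\<Sum>g\<in>binary_seqs l. acorr l g s))"
    by (subst sum.swap) (simp add: sum_distrib_left)
  also have "\<dots> = 0"
    by (intro sum.neutral ballI) (auto simp: shifts_def sum_acorr_eq_0)
  finally show ?thesis .
qed

lemma expect_CDF:
  assumes "l > 0"
  shows "expect_pair l CDF = 1"
proof -
  have card: "real (card (binary_seqs l)) * real (card (binary_seqs l)) = 2 ^ (2 * l)"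
    using card_seq_pairs[of l]
    by (simp add: seq_pairs_def card_cartesian_product flip: of_nat_mult)
  have "expect_pair l CDF = (\<Sum>f\<in>binary_seqs l. \<Sum>g\<in>binary_seqs l.
      1 + (\<Sum>s\<in>shifts l. acorr l f s * acorr l g s) / (real l)\<^sup>2) / 2 ^ (2 * l)"
    using assms by (simp add: expect_pair_eq_sum CDF_binary)
  also have "\<dots> = 1"
    using card sum_acorr_products_eq_0[of l] by (simp add: sum.distrib flip: sum_divide_distrib)
  finally show ?thesis .
qed

section \<open>Central moments as sums of squares\<close>

lemma central_moment_CDF:
  assumes "l > 0"
  shows "central_moment_pair l p CDF =
    (\<Sum>f\<in>binary_seqs l. \<Sum>g\<in>binary_seqs l. (\<Sum>s\<in>shifts l. acorr l f s * acorr l g s) ^ p)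
      / ((real l)\<^sup>2 ^ p * 2 ^ (2 * l))"
  unfolding central_moment_pair_def expect_CDF[OF assms]
  using assms
  by (simp add: expect_pair_eq_sum CDF_binary power_divide flip: sum_divide_distrib)

text \<open>Independence and identical distribution of \<open>f\<close> and \<open>g\<close> enter here.\<close>

lemma sum_power_eq_sum_squares:
  fixes a :: "'a \<Rightarrow> 'b \<Rightarrow> real"
  assumes "finite S"
  shows "(\<Sum>f\<in>B. \<Sum>g\<in>B. (\<Sum>s\<in>S. a f s * a g s) ^ p)
    = (\<Sum>t\<in>{..<p} \<rightarrow>\<^sub>E S. (\<Sum>f\<in>B. \<Prod>i<p. a f (t i))\<^sup>2)"
proof -
  have "(\<Sum>s\<in>S. a f s * a g s) ^ p
      = (\<Sum>t\<in>{..<p} \<rightarrow>\<^sub>E S. (\<Prod>i<p. a f (t i)) * (\<Prod>i<p. a g (t i)))" for f g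
    using prod_sum_PiE[of "{..<p}" "\<lambda>_. S" "\<lambda>_ s. a f s * a g s"] assms
    by (simp add: prod.distrib)
  then have "(\<Sum>f\<in>B. \<Sum>g\<in>B. (\<Sum>s\<in>S. a f s * a g s) ^ p)
      = (\<Sum>f\<in>B. \<Sum>t\<in>{..<p} \<rightarrow>\<^sub>E S. \<Sum>g\<in>B. (\<Prod>i<p. a f (t i)) * (\<Prod>i<p. a g (t i)))"
    by (subst sum.swap) simp
  also have "\<dots> = (\<Sum>t\<in>{..<p} \<rightarrow>\<^sub>E S. (\<Sum>f\<in>B. \<Prod>i<p. a f (t i))\<^sup>2)"
    by (subst sum.swap) (simp add: power2_eq_square sum_product)
  finally show ?thesis .
qed

lemma central_moment_CDF_nonneg:
  assumes "l > 0"
  shows "central_moment_pair l p CDF \<ge> 0"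
  unfolding central_moment_CDF[OF assms] sum_power_eq_sum_squares[OF finite_shifts]
  by (intro divide_nonneg_nonneg sum_nonneg) auto

text \<open>Since the moment is a positive multiple of a sum of squares, one tuple \<open>t\<close>
  with a nonzero term suffices.\<close>

lemma central_moment_CDF_pos:
  assumes "l > 0" and "\<And>i. i < p \<Longrightarrow> t i \<in> shifts l"
    and "(\<Sum>f\<in>binary_seqs l. \<Prod>i<p. acorr l f (t i)) \<noteq> 0"
  shows "central_moment_pair l p CDF > 0"
proof -
  have "0 < (\<Sum>t\<in>{..<p} \<rightarrow>\<^sub>E shifts l. (\<Sum>f\<in>binary_seqs l. \<Prod>i<p. acorr l f (t i))\<^sup>2)"
    \<comment> \<open>The index set contains only extensional functions, hence the restriction of
      \<open>t\<close>.\<close>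
    by (rule sum_pos2[of _ "restrict t {..<p}"])
       (use assms in \<open>auto intro!: finite_PiE\<close>)
  then show ?thesis
    unfolding central_moment_CDF[OF assms(1)] sum_power_eq_sum_squares[OF finite_shifts]
    using assms(1) by simp
qed

section \<open>Autocorrelations at shifts 1, \<open>l - 2\<close> and \<open>l - 1\<close>\<close>

lemma acorr_nonneg_shift:
  assumes "f \<in> binary_seqs l" "m \<le> l"
  shows "acorr l f (int l - int m) = (\<Sum>j\<in>{0..<int m}. Re (f (j + (int l - int m))) * Re (f j))"
  unfolding acorr_def
  \<comment> \<open>For \<open>j \<ge> m\<close> the index \<open>j + (l - m)\<close> is at least
    \<open>l\<close>, so only \<open>m\<close> positions overlap.\<close>
  by (rule sum.mono_neutral_right) (use assms binary_seqs_Re(2)[OF assms(1)] in auto)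

lemma acorr_last:
  assumes "f \<in> binary_seqs l" "l > 0"
  shows "acorr l f (int l - 1) = Re (f (int l - 1)) * Re (f 0)"
proof -
  have "{0..<1} = {0::int}"
    by auto
  then show ?thesis
    using acorr_nonneg_shift[of f l 1] assms by simp
qed

text \<open>Only one product of two signs survives at this shift. Hence a tuple can be padded by an
  even number of entries \<open>l - 1\<close> without changing its product.\<close>

lemma acorr_last_squared:
  assumes "f \<in> binary_seqs l" "l > 0"
  shows "acorr l f (int l - 1) ^ 2 = 1"
  using binary_seqs_Re(3)[OF assms(1), of 0] binary_seqs_Re(3)[OF assms(1), of "int l - 1"] assms
  by (simp add: acorr_last power2_eq_square algebra_simps)

text \<open>Distinct adjacent products are uncorrelated, and for \<open>i = j\<close> the summand is
  a square.\<close>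

lemma sum_adjacent_products_nonneg:
  assumes "i \<in> {0..<int l - 1}"
  shows "(\<Sum>f\<in>binary_seqs l. (Re (f i) * Re (f (i + 1))) * (Re (f j) * Re (f (j + 1)))) \<ge> 0"
proof (cases "i = j")
  case True
  then show ?thesis
    by (intro sum_nonneg) simp
next
  case False
  \<comment> \<open>negating an initial segment ending at \<open>i\<close> affects no adjacent product except the one at \<open>i\<close>\<close>
  have "(\<Sum>f\<in>binary_seqs l. (Re (f i) * Re (f (i + 1))) * (Re (f j) * Re (f (j + 1)))) = 0"
    by (rule sum_odd_eq_0[where S = "{..i}"]) (use False in \<open>auto simp: Re_negate_on\<close>)
  then show ?thesis
    by simp
qed

text \<open>Multiplying the last two autocorrelations cancels a squared end entry in each term,
  leaving the first and last adjacent products; the autocorrelation at shift 1 is the sum of all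
  adjacent products.\<close>

lemma acorr_triple:
  assumes f: "f \<in> binary_seqs l" and l: "l \<ge> 3"
  shows "acorr l f 1 * acorr l f (int l - 2) * acorr l f (int l - 1)
    = (\<Sum>j\<in>{0..<int l - 1}. \<Sum>i\<in>{0, int l - 2}.
        (Re (f i) * Re (f (i + 1))) * (Re (f j) * Re (f (j + 1))))"
proof -
  let ?f = "\<lambda>j. Re (f j)"
  have "{0..<2} = {0, 1::int}"
    by auto
  then have a2: "acorr l f (int l - 2) = ?f (int l - 2) * ?f 0 + ?f (int l - 1) * ?f 1"
    using acorr_nonneg_shift[OF f, of 2] l by (simp add: algebra_simps)
  have sq: "?f 0 * ?f 0 = 1" "?f (int l - 1) * ?f (int l - 1) = 1"
    using binary_seqs_Re(3)[OF f] l by auto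
  have "acorr l f (int l - 2) * acorr l f (int l - 1)
      = (?f 0 * ?f 0) * (?f (int l - 2) * ?f (int l - 1))
        + (?f (int l - 1) * ?f (int l - 1)) * (?f 0 * ?f 1)"
    using l by (simp add: a2 acorr_last[OF f] algebra_simps)
  \<comment> \<open>Here \<open>l \<ge> 3\<close> makes 0 and \<open>l - 2\<close> distinct, so the
    sum really has two terms.\<close>
  also have "\<dots> = (\<Sum>i\<in>{0, int l - 2}. ?f i * ?f (i + 1))"
    using l by (simp add: sq)
  finally have "acorr l f (int l - 2) * acorr l f (int l - 1)
    = (\<Sum>i\<in>{0, int l - 2}. ?f i * ?f (i + 1))" .
  moreover have "acorr l f 1 = (\<Sum>j\<in>{0..<int l - 1}. ?f j * ?f (j + 1))"
    using acorr_nonneg_shift[OF f, of "l - 1"] l by (simp add: of_nat_diff mult.commute)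
  ultimately show ?thesis
    by (simp only: mult.assoc sum_product) (simp only: mult_ac)
qed

text \<open>By \<open>acorr_triple\<close> this is a sum of nonnegative correlations of adjacent
  products, and the one with \<open>i = j = 0\<close> counts all binary sequences.\<close>

lemma sum_acorr_triple_pos:
  assumes l: "l \<ge> 3"
  shows "(\<Sum>f\<in>binary_seqs l. acorr l f 1 * acorr l f (int l - 2) * acorr l f (int l - 1)) > 0"
proof -
  define E where "E i j = (\<Sum>f\<in>binary_seqs l.
    (Re (f i) * Re (f (i + 1))) * (Re (f j) * Re (f (j + 1))))" for i j
  have nonneg: "E i j \<ge> 0" if "i \<in> {0, int l - 2}" for i j
    unfolding E_def using that l by (intro sum_adjacent_products_nonneg) auto
  have "Re (f 0) * Re (f 1) * (Re (f 0) * Re (f 1)) = 1" if "f \<in> binary_seqs l" for f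
    using binary_seqs_Re(3)[OF that, of 0] binary_seqs_Re(3)[OF that, of 1] l
    by (simp add: algebra_simps)
  then have "E 0 0 > 0"
    by (simp add: E_def card_gt_0_iff finite_binary_seqs binary_seqs_nonempty)
  then have "0 < (\<Sum>i\<in>{0, int l - 2}. E i 0)"
    by (intro sum_pos2[of _ 0]) (use nonneg in auto)
  then have "0 < (\<Sum>j\<in>{0..<int l - 1}. \<Sum>i\<in>{0, int l - 2}. E i j)"
    by (rule sum_pos2[of _ 0, rotated 2]) (use nonneg l in \<open>auto intro: sum_nonneg\<close>)
  also have "\<dots> = (\<Sum>f\<in>binary_seqs l. \<Sum>j\<in>{0..<int l - 1}. \<Sum>i\<in>{0, int l - 2}.
        (Re (f i) * Re (f (i + 1))) * (Re (f j) * Re (f (j + 1))))"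
    unfolding E_def
    by (subst (2) sum.swap, rule sum.cong[OF refl], rule sum.swap)
  also have "\<dots> = (\<Sum>f\<in>binary_seqs l. acorr l f 1 * acorr l f (int l - 2) * acorr l f (int l - 1))"
    using l by (intro sum.cong refl acorr_triple[symmetric])
  finally show ?thesis .
qed

section \<open>Positivity and vanishing of the moments\<close>

lemma central_moment_CDF_pos_even:
  assumes l: "l \<ge> 2" and "even p"
  shows "central_moment_pair l p CDF > 0"
proof (rule central_moment_CDF_pos[where t = "\<lambda>_. int l - 1"])
  have "acorr l f (int l - 1) ^ p = 1" if "f \<in> binary_seqs l" for f
    using \<open>even p\<close> acorr_last_squared[OF that] l by (auto simp: power_mult elim!: evenE)
  then show "(\<Sum>f\<in>binary_seqs l. \<Prod>i<p. acorr l f (int l - 1)) \<noteq> 0"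
    by (simp add: finite_binary_seqs binary_seqs_nonempty)
qed (use l in \<open>auto simp: shifts_def\<close>)

lemma central_moment_CDF_pos_odd:
  assumes l: "l \<ge> 3" and p: "p \<ge> 3" "odd p"
  shows "central_moment_pair l p CDF > 0"
proof -
  define t where "t i = (if i = 0 then 1 else if i = 1 then int l - 2 else int l - 1)" for i :: nat
  \<comment> \<open>Beyond the first three entries \<open>t\<close> has \<open>2 * k\<close> entries
    \<open>l - 1\<close>, whose autocorrelations multiply to 1.\<close>
  obtain k where k: "p = Suc (Suc (Suc (2 * k)))"
  proof -
    have "even (p - 3)"
      using p by simp
    then obtain k where "p - 3 = 2 * k"
      by (elim evenE)
    then show thesis
      using p by (intro that[of k]) linarith
  qed
  have "(\<Prod>i<p. acorr l f (t i)) = acorr l f 1 * acorr l f (int l - 2) * acorr l f (int l - 1)"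
    if "f \<in> binary_seqs l" for f
    using acorr_last_squared[OF that] l
    by (simp add: k t_def prod.lessThan_Suc_shift power_mult del: prod.lessThan_Suc)
  then have "(\<Sum>f\<in>binary_seqs l. \<Prod>i<p. acorr l f (t i)) \<noteq> 0"
    using sum_acorr_triple_pos[OF l] by simp
  moreover have "t i \<in> shifts l" for i
    using l by (simp add: t_def shifts_def)
  ultimately show ?thesis
    using l by (intro central_moment_CDF_pos[where t = t]) auto
qed

lemma central_moment_CDF_length_1:
  assumes "p > 0"
  shows "central_moment_pair 1 p CDF = 0"
proof -
  \<comment> \<open>A sequence of length 1 does not overlap its nonzero shifts.\<close>
  have "acorr 1 f s = 0" if "f \<in> binary_seqs 1" "s \<in> shifts 1" for f s
    using that binary_seqs_Re(2)[OF that(1)] by (auto simp: acorr_def shifts_def)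
  then show ?thesis
    using assms by (simp add: central_moment_CDF power_0_left)
qed

lemma central_moment_CDF_length_2:
  assumes "odd p"
  shows "central_moment_pair 2 p CDF = 0"
proof -
  \<comment> \<open>At shifts 1 and -1 the value is \<open>f 0 * f 1\<close>, which is odd in
    \<open>f 0\<close>; at 2 and -2 it is zero.\<close>
  have neg: "acorr 2 (negate_on {0} f) s = - acorr 2 f s"
    if f: "f \<in> binary_seqs 2" and s: "s \<in> shifts 2" for f s
  proof -
    have "{0..<2} = {0, 1::int}"
      by auto
    moreover have "s \<in> {-2, -1, 1, 2}"
      using s by (auto simp: shifts_def)
    ultimately show ?thesis
      using binary_seqs_Re(2)[OF f] by (auto simp: acorr_def Re_negate_on)
  qed
  have "(\<Sum>f\<in>binary_seqs 2. \<Sum>g\<in>binary_seqs 2. (\<Sum>s\<in>shifts 2. acorr 2 f s * acorr 2 g s) ^ p) = 0"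
    using assms
    by (intro sum_odd_eq_0[where S = "{0}"]) (simp add: neg sum_negf)
  then show ?thesis
    by (simp add: central_moment_CDF)
qed

theorem theorem1p7:
  fixes l p :: nat
  assumes "l > 0" and "p > 0"
  shows "central_moment_pair l p CDF \<ge> 0 \<and>
    (if p = 1 \<or> (odd p \<and> l \<le> 2) \<or> (even p \<and> l \<le> 1)
     then central_moment_pair l p CDF = 0
     else central_moment_pair l p CDF > 0)"
proof -
  have "central_moment_pair l p CDF = 0" if "p = 1 \<or> (odd p \<and> l \<le> 2) \<or> (even p \<and> l \<le> 1)"
  proof -
    \<comment> \<open>The cases are regrouped by reason: mean zero, no overlap, and oddness under a
      sign change.\<close>
    have "p = 1 \<or> l = 1 \<or> l = 2 \<and> odd p"
      using that assms by presburger
    then consider "p = 1" | "l = 1" | "l = 2" "odd p"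
      by blast
    then show ?thesis
    proof cases
      case 1
      then show ?thesis
        using assms(1) by (simp add: central_moment_CDF sum_acorr_products_eq_0)
    qed (use assms central_moment_CDF_length_1 central_moment_CDF_length_2 in auto)
  qed
  moreover have "central_moment_pair l p CDF > 0"
    if "\<not> (p = 1 \<or> (odd p \<and> l \<le> 2) \<or> (even p \<and> l \<le> 1))"
  proof (cases "even p")
    case True
    then show ?thesis
      using that by (intro central_moment_CDF_pos_even) auto
  next
    case False
    then have "p \<ge> 3" "l \<ge> 3"
      using that assms by (auto elim!: oddE)
    then show ?thesis
      using False by (intro central_moment_CDF_pos_odd)
  qed
  ultimately show ?thesis
    using central_moment_CDF_nonneg[OF assms(1)] by auto
qed

end
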